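(* Let $n\ge 2$ be an integer, let $q\ne 0,1$ be a complex number, and let $t$ be a complex number. Then the characteristic polynomial of the matrix $P=[q^{j-k}+t]_{1\le j,k\le n}$ is $$\det(xI_n-P)=x^{n-2}\left(x^2-n(t+1)x+t\left(n^2-q^{1-n}[n]_q^2\right)\right).$$
   Context: $I_n$ is the $n\times n$ identity matrix. For an integer $m$ and a complex number $q\neq 0,1$, $[m]_q=\frac{q^m-1}{q-1}$, and $[n]_q^2$ means $([n]_q)^2$. *)

theory Defs
  imports Complex_Main "Jordan_Normal_Form.Char_Poly"
begin

text \<open>The $q$-number $[m]_q$ of an integer $m$; meaningful for $q \neq 0, 1$.\<close>

definition q_number :: "complex \<Rightarrow> int \<Rightarrow> complex" where
  "q_number q m = (q powi m - 1) / (q - 1)"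

text \<open>Matrix indices start at 0 rather than 1; since an entry depends only on the difference
  of its row and column index, this is the same matrix.\<close>

definition P_mat :: "nat \<Rightarrow> complex \<Rightarrow> complex \<Rightarrow> complex mat" where
  "P_mat n q t = mat n n (\<lambda>(j, k). q powi (int j - int k) + t)"

end

theory Submission
  imports Defs
begin

text \<open>The matrix has rank at most two: $q^{j-k} + t = q^j \cdot q^{-k} + 1 \cdot t$, so it is a product
  $UV$ with $U$ of size $n \times 2$ and $V$ of size $2 \times n$. For such products
  $x^2 \det(xI_n - UV) = x^n \det(xI_2 - VU)$ (lemma \<open>char_poly_mult_commute_rectangular\<close>), which
  leaves the characteristic polynomial of the $2 \times 2$ matrix $VU$. Its diagonal entries are
  $n$ and $nt$, and its off-diagonal entries are the geometric sum $\sum_{k<n} q^{-k} = q^{1-n}[n]_q$ and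
  $t \sum_{j<n} q^j = t[n]_q$; minus its trace and its determinant are the coefficients in the claim.\<close>

lemma char_poly_block_lower_triangular:
  fixes A :: "'a :: idom mat"
  assumes A: "A \<in> carrier_mat n n" and B: "B \<in> carrier_mat m n" and D: "D \<in> carrier_mat m m"
  shows "char_poly (four_block_mat A (0\<^sub>m n m) B D) = char_poly A * char_poly D"
proof -
  have "char_poly_matrix (four_block_mat A (0\<^sub>m n m) B D) =
      four_block_mat (char_poly_matrix A) (0\<^sub>m n m) (map_mat (\<lambda>a. [:- a:]) B) (char_poly_matrix D)"
    using A B D by (intro eq_matI) (auto simp: char_poly_matrix_def)
  moreover have "det \<dots> = det (char_poly_matrix A) * det (char_poly_matrix D)"
    using A B D by (intro det_four_block_mat_upper_right_zero[where n = n and m = m]) auto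
  ultimately show ?thesis
    by (simp add: char_poly_def)
qed

lemma char_poly_zero_mat: "char_poly (0\<^sub>m n n :: 'a :: idom mat) = monom 1 n"
proof -
  have "diag_mat (0\<^sub>m n n :: 'a mat) = replicate n 0"
    by (intro nth_equalityI) (auto simp: diag_mat_def)
  then have "char_poly (0\<^sub>m n n :: 'a mat) = [:0, 1:] ^ n"
    by (subst char_poly_upper_triangular[where n = n]) (auto simp: upper_triangular_def)
  also have "\<dots> = monom 1 n"
    by (simp add: monom_altdef)
  finally show ?thesis .
qed

text \<open>Passing to square matrices of size $n + m$ turns the comparison of $AB$ with $BA$ into a
  similarity: conjugation by the unipotent block matrix with $A$ in its upper right corner moves the
  block $BA$ at the lower right of the matrix \<open>?R\<close> below to the block $AB$ at the upper left of
  \<open>?L\<close>. The zero blocks on the diagonals account for the powers of $x$.\<close>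

lemma char_poly_mult_commute_rectangular:
  fixes A :: "'a :: idom mat"
  assumes A: "A \<in> carrier_mat n m" and B: "B \<in> carrier_mat m n"
  shows "monom 1 m * char_poly (A * B) = monom 1 n * char_poly (B * A)"
proof -
  let ?L = "four_block_mat (A * B) (0\<^sub>m n m) B (0\<^sub>m m m)"
  let ?R = "four_block_mat (0\<^sub>m n n) (0\<^sub>m n m) B (B * A)"
  let ?S = "four_block_mat (1\<^sub>m n) A (0\<^sub>m m n) (1\<^sub>m m)"
  let ?T = "four_block_mat (1\<^sub>m n) (- A) (0\<^sub>m m n) (1\<^sub>m m)"
  have ABA: "A * B * A = A * (B * A)"
    using A B by (simp add: assoc_mult_mat[where n\<^sub>1 = n])
  have neg_zero: "- 0\<^sub>m m m = (0\<^sub>m m m :: 'a mat)"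
    by (intro eq_matI) auto
  have cancel: "A + - A = 0\<^sub>m n m"
    using A by (intro eq_matI) auto
  have ST: "?S * ?T = 1\<^sub>m (n + m)" and TS: "?T * ?S = 1\<^sub>m (n + m)"
    using A by (simp_all add: mult_four_block_mat[where ?nr1.0 = n and ?n1.0 = n and ?n2.0 = m
      and ?nr2.0 = m and ?nc1.0 = n and ?nc2.0 = m] neg_zero cancel)
  have "?S * ?R = four_block_mat (A * B) (A * (B * A)) B (B * A)"
    using A B by (subst mult_four_block_mat[where ?nr1.0 = n and ?n1.0 = n and ?n2.0 = m]) auto
  also have "\<dots> * ?T = four_block_mat (A * B) (A * B * (- A) + A * (B * A)) B (B * (- A) + B * A)"
    using A B by (subst mult_four_block_mat[where ?nr1.0 = n and ?n1.0 = n and ?n2.0 = m]) auto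
  also have "\<dots> = ?L"
    using A B by (simp add: ABA uminus_l_inv_mat[where nr = n and nc = m]
      uminus_l_inv_mat[where nr = m and nc = m])
  finally have "?L = ?S * ?R * ?T"
    by simp
  then have "similar_mat ?L ?R"
    using A B ST TS
    by (intro similar_matI[where P = ?S and Q = ?T and n = "n + m"]) auto
  then have "char_poly ?L = char_poly ?R"
    by (rule char_poly_similar)
  then show ?thesis
    using A B by (simp add: char_poly_block_lower_triangular[where n = n and m = m]
      char_poly_zero_mat mult.commute)
qed

lemma char_poly_dim_2:
  fixes A :: "'a :: idom mat"
  assumes A: "A \<in> carrier_mat 2 2"
  shows "char_poly A =
    [: A $$ (0,0) * A $$ (1,1) - A $$ (0,1) * A $$ (1,0), - (A $$ (0,0) + A $$ (1,1)), 1 :]"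
proof -
  have "char_poly_matrix A \<in> carrier_mat 2 2"
    using A by simp
  then show ?thesis
    unfolding char_poly_def using A
    by (subst laplace_expansion_row[where i = 0])
       (auto simp: cofactor_def det_single mat_delete_def numeral_2_eq_2 char_poly_matrix_def)
qed

text \<open>Reversing the order of summation replaces $-k$ by $k - (n - 1)$, and $q^{1-n}$ factors out.\<close>

lemma sum_inverse_powers:
  fixes q :: "'a :: field"
  assumes "q \<noteq> 0"
  shows "(\<Sum>k<n. q powi (- int k)) = q powi (1 - int n) * (\<Sum>k<n. q ^ k)"
proof -
  have "(\<Sum>k<n. q powi (- int k)) = (\<Sum>k<n. q powi (- int (n - Suc k)))"
    by (rule sum.nat_diff_reindex[symmetric])
  also have "\<dots> = (\<Sum>k<n. q powi (1 - int n) * q ^ k)"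
  proof (rule sum.cong)
    fix k assume "k \<in> {..<n}"
    then have "- int (n - Suc k) = (1 - int n) + int k"
      by auto
    then show "q powi (- int (n - Suc k)) = q powi (1 - int n) * q ^ k"
      using assms by (metis power_int_add power_int_of_nat)
  qed simp
  finally show ?thesis
    by (simp add: sum_distrib_left)
qed

theorem theorem1p2:
  fixes n :: nat and q t :: complex
  assumes "n \<ge> 2" and "q \<noteq> 0" and "q \<noteq> 1"
  shows "char_poly (P_mat n q t) =
    monom 1 (n - 2) *
      [: t * ((of_nat n)\<^sup>2 - q powi (1 - int n) * (q_number q (int n))\<^sup>2),
         - (of_nat n * (t + 1)),
         1 :]"
proof -
  define U where "U = mat n 2 (\<lambda>(j, c). if c = 0 then q powi int j else 1)"
  define V where "V = mat 2 n (\<lambda>(c, k). if c = 0 then q powi (- int k) else t)"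
  have U: "U \<in> carrier_mat n 2" and V: "V \<in> carrier_mat 2 n"
    by (auto simp: U_def V_def)
  have P: "P_mat n q t = U * V"
    using assms(2)
    by (intro eq_matI) (auto simp: P_mat_def U_def V_def scalar_prod_def numeral_2_eq_2
      power_int_diff power_int_minus field_simps)
  have qn: "(\<Sum>k<n. q ^ k) = q_number q (int n)"
    using assms(3) by (simp add: q_number_def geometric_sum)
  have entries: "(V * U) $$ (0, 0) = of_nat n" "(V * U) $$ (1, 1) = of_nat n * t"
     "(V * U) $$ (1, 0) = t * q_number q (int n)"
     "(V * U) $$ (0, 1) = q powi (1 - int n) * q_number q (int n)"
    using assms(2) sum_inverse_powers[OF assms(2), of n]
    by (auto simp: U_def V_def scalar_prod_def atLeast0LessThan power_int_minus qn
       simp flip: sum_distrib_left)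
  have "char_poly (V * U) =
      [: t * ((of_nat n)\<^sup>2 - q powi (1 - int n) * (q_number q (int n))\<^sup>2),
         - (of_nat n * (t + 1)), 1 :]" (is "_ = ?c")
    unfolding char_poly_dim_2[OF mult_carrier_mat[OF V U]] entries
    by (simp add: power2_eq_square algebra_simps)
  then have "monom 1 2 * char_poly (P_mat n q t) = monom 1 n * ?c"
    using char_poly_mult_commute_rectangular[OF U V] by (simp add: P)
  \<comment> \<open>Since \<open>n \<ge> 2\<close>, the factor \<open>x\<^sup>2\<close> on the left can be cancelled.\<close>
  also have "monom 1 n = monom (1 :: complex) 2 * monom 1 (n - 2)"
    using assms(1) by (simp only: mult_monom le_add_diff_inverse mult_1)
  finally show ?thesis
    by (simp add: mult.assoc del: mult_pCons_right)
qed

end
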